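(* Let $\phi=(1+\sqrt5)/2$ and let $(L_n)$ be the Lucas numbers. For every positive integer $k$, \[ \tan^{-1}\phi^{2k-1}=2\tan^{-1}1-\frac{1}{2}\tan^{-1}\left(\frac{2}{L_{2k-1}}\right). \]
   Context: $\phi=(1+\sqrt5)/2$ is the golden ratio. The Fibonacci numbers are defined by $F_0=0$, $F_1=1$, $F_n=F_{n-1}+F_{n-2}$. The Lucas numbers are $L_n=F_{n-1}+F_{n+1}$. $\tan^{-1}$ denotes the principal branch of the arctangent, with values in $(-\pi/2,\pi/2)$. *)

theory Defs
  imports Complex_Main "HOL-Number_Theory.Fib"
begin

definition golden_ratio :: real where
  "golden_ratio = (1 + sqrt 5) / 2"

text \<open>
  The second equation is \<open>L\<^sub>m = F\<^sub>m\<^sub>-\<^sub>1 + F\<^sub>m\<^sub>+\<^sub>1\<close> for \<open>m = n + 1\<close>. At \<open>0\<close> that formula involves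
  \<open>F\<^sub>-\<^sub>1 = 1\<close>, which the type \<^typ>\<open>nat\<close> cannot index, so the value \<open>L\<^sub>0 = 2\<close> is given directly.
\<close>
fun lucas :: "nat \<Rightarrow> nat" where
  "lucas 0 = 2"
| "lucas (Suc n) = fib n + fib (n + 2)"

end

theory Submission
  imports Defs
begin

text \<open>
  For odd \<open>n\<close> Binet's formula gives \<open>L\<^sub>n = x - 1/x\<close> with \<open>x = \<phi>\<^sup>n > 1\<close>, so
  \<open>2/L\<^sub>n = 2y/(1 - y\<^sup>2)\<close> with \<open>y = 1/x < 1\<close>. This is the tangent of the doubled angle \<open>2 arctan y\<close>,
  and \<open>arctan y = \<pi>/2 - arctan x\<close>.
\<close>

lemma lucas_Suc_Suc: "lucas (Suc (Suc n)) = lucas (Suc n) + lucas n"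
  by (cases n) (simp_all add: numeral_2_eq_2)

lemma golden_ratio_gt_1: "golden_ratio > 1"
proof -
  have "sqrt 5 > sqrt 1" by (rule real_sqrt_less_mono) simp
  then show ?thesis by (simp add: golden_ratio_def)
qed

lemma golden_ratio_square: "golden_ratio * golden_ratio = golden_ratio + 1"
  by (simp add: golden_ratio_def field_simps)

text \<open>Both \<open>golden_ratio\<close> and \<open>1 - golden_ratio\<close> are roots of
  \<open>x * x = x + 1\<close>, so their powers obey the recurrence \<open>lucas_Suc_Suc\<close>;
  \<open>fib.induct\<close> provides the matching two-step induction.\<close>

lemma lucas_binet: "real (lucas n) = golden_ratio ^ n + (1 - golden_ratio) ^ n"
proof (induction n rule: fib.induct)
  case 1
  show ?case by simp
next
  case 2
  show ?case by simp
next
  case (3 n)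
  have power_rec: "x ^ Suc (Suc n) = x ^ Suc n + x ^ n" if "x * x = x + 1" for x :: real
  proof -
    have "x ^ Suc (Suc n) = (x * x) * x ^ n" by simp
    then show ?thesis by (simp only: that) (simp add: algebra_simps)
  qed
  have "(1 - golden_ratio) * (1 - golden_ratio) = (1 - golden_ratio) + 1"
    using golden_ratio_square by (simp add: algebra_simps)
  then show ?case
    using 3 power_rec[OF golden_ratio_square] power_rec[of "1 - golden_ratio"]
    by (simp add: lucas_Suc_Suc del: power_Suc lucas.simps)
qed

text \<open>The conjugate root is \<open>- (1 / golden_ratio)\<close>, and an odd power keeps its
  minus sign.\<close>

lemma lucas_odd:
  assumes "odd n"
  shows "real (lucas n) = golden_ratio ^ n - 1 / golden_ratio ^ n"
proof -
  have "1 - golden_ratio = - (1 / golden_ratio)"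
    using golden_ratio_square golden_ratio_gt_1 by (simp add: field_simps)
  then show ?thesis
    using assms by (simp add: lucas_binet power_one_over)
qed

theorem theorem1:
  fixes k :: nat
  assumes "k > 0"
  shows "arctan (golden_ratio ^ (2 * k - 1)) =
    2 * arctan 1 - 1 / 2 * arctan (2 / real (lucas (2 * k - 1)))"
proof -
  define x where "x = golden_ratio ^ (2 * k - 1)"
  \<comment> \<open>Since \<open>k > 0\<close>, the truncated subtraction gives a positive
    exponent.\<close>
  have "x > 1"
    unfolding x_def using assms golden_ratio_gt_1 by (intro one_less_power) auto
  have "real (lucas (2 * k - 1)) = x - 1 / x"
    unfolding x_def using assms by (intro lucas_odd) simp
  moreover have "2 / (x - 1 / x) = 2 * (1 / x) / (1 - (1 / x)\<^sup>2)"
  proof -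
    \<comment> \<open>Keeps both denominators nonzero when fractions are cleared.\<close>
    have "x * x \<noteq> 1"
      using \<open>x > 1\<close> less_1_mult[of x x] by simp
    then show ?thesis
      using \<open>x > 1\<close> by (simp add: divide_simps power2_eq_square)
  qed
  \<comment> \<open>As \<open>1 / x\<close> lies strictly between 0 and 1, the doubled angle stays
    inside the principal branch.\<close>
  moreover have "2 * arctan (1 / x) = arctan (2 * (1 / x) / (1 - (1 / x)\<^sup>2))"
    using \<open>x > 1\<close> by (intro arctan_double) simp
  moreover have "arctan (1 / x) = pi / 2 - arctan x"
    using \<open>x > 1\<close> arctan_inverse[of x] by simp
  ultimately show ?thesis
    unfolding x_def[symmetric] arctan_one by simp
qed

end
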